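(* Let $m$ be odd, let $\mathbb{S}\subset\mathbb{P}_m(\mathbb{C}^{n\times n})$ be either the set of $T$-even or the set of $T$-odd matrix polynomials, let $P\in\mathbb{S}$ be regular, and let $\epsilon>0$ (with $\infty$ not in the relevant $\epsilon$-pseudospectra of $P$). Then for the Frobenius norm, for every $\lambda\in\mathbb{T}:=\{z\in\mathbb{C}:|z|=1\}$, $$\eta_F^{\mathbb{S}}(\lambda,P)=\sqrt2\,\eta(\lambda,P),\quad\text{and}\quad\sigma_\epsilon^{\mathbb{S}}(P)\cap\mathbb{T}=\sigma_{\epsilon/\sqrt2}(P)\cap\mathbb{T}.$$
   Context: $m,n\ge1$ are integers. $\mathbb{P}_m(\mathbb{C}^{n\times n})$ is the vector space of matrix polynomials $P(z)=\sum_{j=0}^m z^jA_j$, $A_j\in\mathbb{C}^{n\times n}$. $P$ is regular if $\det P(z)\not\equiv0$; $T$-even if $P(z)^T=P(-z)$ for all $z$; $T$-odd if $P(z)^T=-P(-z)$ for all $z$. $\sigma(P):=\{z\in\mathbb{C}:\det P(z)=0\}$. $|||P|||_F:=\left(\sum_{j=0}^m\|A_j\|_F^2\right)^{1/2}$ with $\|\cdot\|_F$ the Frobenius norm. For $x\in\mathbb{C}^n$ with $\|x\|_2=1$: $\eta(\lambda,x,P):=\inf\{|||\Delta P|||_F:\Delta P\in\mathbb{P}_m(\mathbb{C}^{n\times n}),\ P(\lambda)x+\Delta P(\lambda)x=0\}=\|P(\lambda)x\|_2/\|[1,\lambda,\ldots,\lambda^m]^T\|_2$ and $\eta_F^{\mathbb{S}}(\lambda,x,P):=\inf\{|||\Delta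 P|||_F:\Delta P\in\mathbb{S},\ P(\lambda)x+\Delta P(\lambda)x=0\}$. Backward errors of $\lambda$: $\eta(\lambda,P):=\min_{\|x\|_2=1}\eta(\lambda,x,P)$, $\eta_F^{\mathbb{S}}(\lambda,P):=\min_{\|x\|_2=1}\eta_F^{\mathbb{S}}(\lambda,x,P)$. Pseudospectra: $\sigma_\epsilon(P):=\bigcup\{\sigma(P+\Delta P):\Delta P\in\mathbb{P}_m(\mathbb{C}^{n\times n}),\ |||\Delta P|||_F\le\epsilon\}$ and $\sigma_\epsilon^{\mathbb{S}}(P):=\bigcup\{\sigma(P+\Delta P):\Delta P\in\mathbb{S},\ |||\Delta P|||_F\le\epsilon\}$. Only finite eigenvalues are considered; the paper assumes throughout, for simplicity, that $\infty\notin\sigma_\epsilon(P)$. *)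

theory Defs
  imports "HOL-Analysis.Analysis" "HOL-Computational_Algebra.Polynomial"
begin

text \<open>
  A matrix polynomial is an element of \<^typ>\<open>(complex^'n^'n) poly\<close>. The library function
  \<^const>\<open>poly\<close> would multiply coefficient matrices entrywise and expects a matrix argument, so
  evaluation at a scalar is defined here.
\<close>

definition mp_eval :: "(complex^'n^'n) poly \<Rightarrow> complex \<Rightarrow> complex^'n^'n" where
  "mp_eval P z = (\<chi> i k. \<Sum>j\<le>degree P. z ^ j * coeff P j $ i $ k)"

definition mat_polys :: "nat \<Rightarrow> (complex^'n^'n) poly set" where
  "mat_polys m = {P. degree P \<le> m}"

definition T_even :: "nat \<Rightarrow> (complex^'n^'n) poly set" where
  "T_even m = {P \<in> mat_polys m. \<forall>z. transpose (mp_eval P z) = mp_eval P (- z)}"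

definition T_odd :: "nat \<Rightarrow> (complex^'n^'n) poly set" where
  "T_odd m = {P \<in> mat_polys m. \<forall>z. transpose (mp_eval P z) = - mp_eval P (- z)}"

definition mp_regular :: "(complex^'n^'n) poly \<Rightarrow> bool" where
  "mp_regular P \<longleftrightarrow> (\<exists>z. det (mp_eval P z) \<noteq> 0)"

definition mp_spectrum :: "(complex^'n^'n) poly \<Rightarrow> complex set" where
  "mp_spectrum P = {z. det (mp_eval P z) = 0}"

text \<open>
  The norm of the type \<^typ>\<open>complex^'n^'n\<close> is the Frobenius norm, and that of
  \<^typ>\<open>complex^'n\<close> is the Euclidean norm.
\<close>

definition mp_norm :: "nat \<Rightarrow> (complex^'n^'n) poly \<Rightarrow> real" where
  "mp_norm m P = sqrt (\<Sum>j\<le>m. (norm (coeff P j))\<^sup>2)"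

text \<open>
  In the following definitions \<open>S\<close> is the set of admissible perturbations; the unstructured
  notions are the case \<open>S = mat_polys m\<close>. The infimum is over a nonempty set of nonnegative
  reals whenever \<open>- P \<in> S\<close>, in particular when \<open>P\<close> belongs to a subspace \<open>S\<close>.
\<close>

definition backward_error_vec ::
    "nat \<Rightarrow> (complex^'n^'n) poly set \<Rightarrow> complex \<Rightarrow> complex^'n \<Rightarrow> (complex^'n^'n) poly \<Rightarrow> real" where
  "backward_error_vec m S \<mu> x P =
     Inf {mp_norm m D | D. D \<in> S \<and> mp_eval P \<mu> *v x + mp_eval D \<mu> *v x = 0}"

text \<open>
  The minimum over an infinite set, hence \<open>LEAST\<close> rather than \<^const>\<open>Min\<close>. It is unspecified,
  and not the infimum, if the minimum is not attained.
\<close>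

definition backward_error ::
    "nat \<Rightarrow> (complex^'n^'n) poly set \<Rightarrow> complex \<Rightarrow> (complex^'n^'n) poly \<Rightarrow> real" where
  "backward_error m S \<mu> P =
     (LEAST r. r \<in> {backward_error_vec m S \<mu> x P | x. norm x = 1})"

definition pseudospectrum ::
    "nat \<Rightarrow> (complex^'n^'n) poly set \<Rightarrow> real \<Rightarrow> (complex^'n^'n) poly \<Rightarrow> complex set" where
  "pseudospectrum m S \<epsilon> P = \<Union> {mp_spectrum (P + D) | D. D \<in> S \<and> mp_norm m D \<le> \<epsilon>}"

text \<open>
  Infinity is an eigenvalue of a matrix polynomial of grade \<open>m\<close> iff \<open>0\<close> is an eigenvalue of its
  reversal \<open>z\<^sup>m P(1/z)\<close>, whose value at \<open>0\<close> is the coefficient of index \<open>m\<close>, possibly zero.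
\<close>

definition infinite_eigenvalue :: "nat \<Rightarrow> (complex^'n^'n) poly \<Rightarrow> bool" where
  "infinite_eigenvalue m P \<longleftrightarrow> det (coeff P m) = 0"

definition infinity_in_pseudospectrum ::
    "nat \<Rightarrow> (complex^'n^'n) poly set \<Rightarrow> real \<Rightarrow> (complex^'n^'n) poly \<Rightarrow> bool" where
  "infinity_in_pseudospectrum m S \<epsilon> P \<longleftrightarrow>
     (\<exists>D \<in> S. mp_norm m D \<le> \<epsilon> \<and> infinite_eigenvalue m (P + D))"

end

theory Submission imports Defs begin

text \<open>
  On the unit circle the minimal norm of a perturbation with prescribed value \<open>M\<close> at \<open>\<mu>\<close> is
  \<open>norm M / sqrt (m + 1)\<close>, obtained by spreading \<open>M\<close> evenly over all coefficients. For a structured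
  perturbation the even and the odd coefficients must produce the symmetric and the skew-symmetric
  part of \<open>M\<close> separately (in this order or, for \<open>T_odd\<close>, in the other). As \<open>m\<close> is odd, there are
  \<open>(m + 1) / 2\<close> coefficients of each kind, and as the two parts of \<open>M\<close> are orthogonal, the minimal
  norm is \<open>norm M / sqrt ((m + 1) / 2)\<close>: every matrix \<open>M\<close> is attainable in both cases, and the costs
  differ by the constant factor \<open>sqrt 2\<close>.
\<close>

section \<open>Frobenius norm, rank-one matrices and kernels\<close>

lemma norm_vec_power2: "(norm (v::'a::real_normed_vector^'n))\<^sup>2 = (\<Sum>i\<in>UNIV. (norm (v $ i))\<^sup>2)"
  by (simp add: norm_vec_def L2_set_def sum_nonneg)

lemma norm_matrix_power2:
  "(norm (A::'a::real_normed_vector^'n^'m))\<^sup>2 = (\<Sum>i\<in>UNIV. \<Sum>k\<in>UNIV. (norm (A $ i $ k))\<^sup>2)"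
  by (simp add: norm_vec_power2)

lemma norm_transpose [simp]: "norm (transpose (A::'a::real_normed_vector^'n^'m)) = norm A"
proof -
  have "(norm (transpose A))\<^sup>2 = (norm A)\<^sup>2"
    unfolding norm_matrix_power2 transpose_def by (subst sum.swap) simp
  then show ?thesis by simp
qed

lemma norm_outer:
  "norm (\<chi> i k. r $ i * s $ k) = norm (r::complex^'m) * norm (s::complex^'n)"
proof -
  have "(norm (\<chi> i k. r $ i * s $ k))\<^sup>2 = (norm r * norm s)\<^sup>2"
    unfolding norm_matrix_power2 power_mult_distrib norm_vec_power2[of r] norm_vec_power2[of s]
    by (simp add: norm_mult power_mult_distrib sum_product)
  then show ?thesis by simp
qed

text \<open>Cauchy-Schwarz for each row, then summation of the squares over the rows.\<close>

lemma norm_matrix_vector_mult_le: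
  "norm ((A::complex^'n^'m) *v x) \<le> norm A * norm x"
proof -
  have row: "cmod ((A *v x) $ i) \<le> norm (A $ i) * norm x" for i
  proof -
    have "cmod ((A *v x) $ i) \<le> (\<Sum>k\<in>UNIV. \<bar>cmod (A $ i $ k)\<bar> * \<bar>cmod (x $ k)\<bar>)"
      unfolding matrix_vector_mult_def by (simp add: norm_mult[symmetric] norm_sum)
    also have "\<dots> \<le> norm (A $ i) * norm x"
      unfolding norm_vec_def by (rule L2_set_mult_ineq)
    finally show ?thesis .
  qed
  have "(norm (A *v x))\<^sup>2 \<le> (\<Sum>i\<in>UNIV. (norm (A $ i) * norm x)\<^sup>2)"
    unfolding norm_vec_power2[of "A *v x"] by (intro sum_mono power_mono row) simp
  also have "\<dots> = (norm A * norm x)\<^sup>2"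
    by (simp add: power_mult_distrib norm_vec_power2[of A] sum_distrib_right)
  finally show ?thesis
    by (rule power2_le_imp_le) simp
qed

text \<open>The rank-one product of the column \<open>r\<close> with the conjugate transpose of
  \<open>x\<close> is a witness. It attains equality in \<open>norm_matrix_vector_mult_le\<close>,
  so prescribing a value at one unit vector costs no more than the norm of that value.\<close>

lemma ex_matrix_mapping_unit_vector:
  fixes x r :: "complex^'n"
  assumes "norm x = 1"
  shows "\<exists>M :: complex^'n^'n. M *v x = r \<and> norm M = norm r"
proof (intro exI conjI)
  define y :: "complex^'n" where "y = (\<chi> k. cnj (x $ k))"
  let ?M = "(\<chi> i k. r $ i * y $ k) :: complex^'n^'n"
  have "(\<Sum>k\<in>UNIV. (cmod (x $ k))\<^sup>2) = 1"
    using norm_vec_power2[of x] assms by simp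
  then have "(\<Sum>k\<in>UNIV. cnj (x $ k) * x $ k) = 1"
    by (metis (no_types, lifting) complex_norm_square mult.commute of_real_1 of_real_sum sum.cong)
  then show "?M *v x = r"
    by (simp add: vec_eq_iff matrix_vector_mult_def y_def mult.assoc sum_distrib_left[symmetric])
  have "norm y = norm x"
    by (simp add: norm_vec_def y_def)
  then show "norm ?M = norm r"
    unfolding norm_outer using assms by simp
qed

lemma det_eq_0_iff_unit_kernel:
  fixes A :: "complex^'n^'n"
  shows "det A = 0 \<longleftrightarrow> (\<exists>x. norm x = 1 \<and> A *v x = 0)"
proof
  assume "det A = 0"
  then obtain x where x: "x \<noteq> 0" "A *v x = 0"
    by (metis invertible_det_nz invertible_left_inverse matrix_left_invertible_ker)
  have "A *v (of_real (inverse (norm x)) *s x) = 0"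
    using x by (metis vector_scalar_commute vector_smult_rzero)
  moreover have "norm (of_real (inverse (norm x)) *s x :: complex^'n) = 1"
  proof -
    \<comment> \<open>Complex and real scaling agree for a real factor: the former commutes with the
      matrix, the latter with the norm.\<close>
    have "complex_of_real (inverse (norm x)) *s x = inverse (norm x) *\<^sub>R x"
      unfolding vec_eq_iff vector_smult_component vector_scaleR_component
        scaleR_conv_of_real[where 'a = complex]
      by blast
    then show ?thesis using x by simp
  qed
  ultimately show "\<exists>x. norm x = 1 \<and> A *v x = 0" by blast
next
  assume "\<exists>x. norm x = 1 \<and> A *v x = 0"
  then show "det A = 0"
    by (metis invertible_det_nz invertible_left_inverse matrix_left_invertible_ker norm_zero
        zero_neq_one)
qed

text \<open>Triangle inequality followed by Cauchy-Schwarz. Equal summands give equality, which is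
  why even spreading is optimal.\<close>

lemma norm_sum_power2_le:
  fixes f :: "'a \<Rightarrow> 'b::real_normed_vector"
  shows "(norm (\<Sum>j\<in>J. f j))\<^sup>2 \<le> card J * (\<Sum>j\<in>J. (norm (f j))\<^sup>2)"
proof -
  have "(norm (\<Sum>j\<in>J. f j))\<^sup>2 \<le> (\<Sum>j\<in>J. norm (f j))\<^sup>2"
    by (intro power_mono norm_sum) simp
  also have "\<dots> \<le> card J * (\<Sum>j\<in>J. (norm (f j))\<^sup>2)"
    using sum_squared_le_sum_of_squares[of "\<lambda>j. norm (f j)" J] by (simp add: mult.commute)
  finally show ?thesis .
qed

section \<open>Complex multiples of matrices and evaluation of matrix polynomials\<close>

text \<open>Powers of the evaluation point are complex, whereas \<open>*\<^sub>R\<close> takes real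
  factors and \<open>*s\<close> on a matrix takes a factor of the row type.\<close>

definition cscale :: "complex \<Rightarrow> complex^'n^'n \<Rightarrow> complex^'n^'n" where
  "cscale c A = (\<chi> i k. c * A $ i $ k)"

lemma norm_cscale: "norm (cscale c A) = cmod c * norm A"
proof -
  have "(norm (cscale c A))\<^sup>2 = (cmod c * norm A)\<^sup>2"
    unfolding norm_matrix_power2 power_mult_distrib
    by (simp add: cscale_def norm_mult power_mult_distrib sum_distrib_left)
  then show ?thesis by simp
qed

lemma cscale_cscale: "cscale a (cscale b A) = cscale (a * b) A"
  by (simp add: cscale_def vec_eq_iff)

lemma cscale_one: "cscale 1 A = A"
  by (simp add: cscale_def vec_eq_iff)

lemma cscale_minus: "cscale (- a) A = - cscale a A"
  by (simp add: cscale_def vec_eq_iff)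

lemma cscale_power_minus_one: "cscale ((- 1) ^ j * a) A = (- 1) ^ j *\<^sub>R cscale a A"
  by (cases "even j") (simp_all add: cscale_minus)

lemma cscale_scaleR: "cscale a (t *\<^sub>R A) = t *\<^sub>R cscale a A"
  by (simp add: cscale_def vec_eq_iff)

lemma transpose_cscale: "transpose (cscale c A) = cscale c (transpose A)"
  by (simp add: cscale_def transpose_def vec_eq_iff)

lemma transpose_add: "transpose (A + B) = transpose A + transpose (B::'a::plus^'n^'m)"
  by (simp add: transpose_def vec_eq_iff)

lemma transpose_diff: "transpose (A - B) = transpose A - transpose (B::'a::minus^'n^'m)"
  by (simp add: transpose_def vec_eq_iff)

lemma transpose_sum:
  "transpose (\<Sum>j\<in>J. f j) = (\<Sum>j\<in>J. transpose (f j :: 'a::comm_monoid_add^'n^'m))"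
  by (simp add: transpose_def vec_eq_iff)

text \<open>Replaces the degree by a common bound \<open>m\<close>; the extra coefficients vanish.
  Sums for different polynomials then have the same index set.\<close>

lemma mp_eval_eq_sum:
  assumes "degree P \<le> m"
  shows "mp_eval P z = (\<Sum>j\<le>m. cscale (z ^ j) (coeff P j))"
proof -
  have "(\<Sum>j\<le>degree P. z ^ j * coeff P j $ i $ k) = (\<Sum>j\<le>m. z ^ j * coeff P j $ i $ k)" for i k
    by (rule sum.mono_neutral_left) (use assms in \<open>auto simp: coeff_eq_0 not_le\<close>)
  then show ?thesis
    by (simp add: mp_eval_def cscale_def vec_eq_iff)
qed

lemma mp_eval_add:
  assumes "degree P \<le> m" "degree Q \<le> m"
  shows "mp_eval (P + Q) z = mp_eval P z + mp_eval Q z"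
  using assms
  by (simp add: mp_eval_eq_sum[of _ m] degree_add_le cscale_def vec_eq_iff sum.distrib
      distrib_left)

lemma ex_poly_of_coeffs:
  fixes A :: "nat \<Rightarrow> 'a::comm_monoid_add"
  shows "\<exists>D. degree D \<le> m \<and> (\<forall>j\<le>m. coeff D j = A j)"
proof (intro exI conjI)
  show "degree (\<Sum>j\<le>m. monom (A j) j) \<le> m"
    by (intro degree_sum_le) (auto intro: order_trans[OF degree_monom_le])
  show "\<forall>j\<le>m. coeff (\<Sum>j\<le>m. monom (A j) j) j = A j"
    by (simp add: coeff_sum)
qed

lemma mp_norm_power2: "(mp_norm m D)\<^sup>2 = (\<Sum>j\<le>m. (norm (coeff D j))\<^sup>2)"
  by (simp add: mp_norm_def sum_nonneg)

lemma mp_norm_nonneg: "0 \<le> mp_norm m D"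
  by (simp add: mp_norm_def sum_nonneg)

section \<open>Backward errors and pseudospectra from the size of the evaluation map\<close>

text \<open>Evaluation at \<open>\<mu>\<close> maps each closed ball of \<open>S\<close> around 0 in
  \<open>mp_norm\<close> onto the closed ball of matrices with \<open>c\<close> times the radius.
  The constant \<open>c\<close> is all that the results at \<open>\<mu>\<close> need to know about
  \<open>S\<close>.\<close>

definition tight_evaluation :: "nat \<Rightarrow> (complex^'n^'n) poly set \<Rightarrow> complex \<Rightarrow> real \<Rightarrow> bool" where
  "tight_evaluation m S \<mu> c \<longleftrightarrow>
     c > 0 \<and> S \<subseteq> mat_polys m \<and>
     (\<forall>D\<in>S. norm (mp_eval D \<mu>) \<le> c * mp_norm m D) \<and>
     (\<forall>M. \<exists>D\<in>S. mp_eval D \<mu> = M \<and> c * mp_norm m D = norm M)"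

text \<open>An admissible \<open>D\<close> must map \<open>x\<close> to the negative residual, which
  bounds its norm from below. A rank-one matrix doing this at the least cost lifts to an element of
  \<open>S\<close>, so the bound is attained.\<close>

lemma tight_evaluation_residual:
  assumes "tight_evaluation m S \<mu> c" "norm x = 1"
  shows "D \<in> S \<Longrightarrow> mp_eval P \<mu> *v x + mp_eval D \<mu> *v x = 0
           \<Longrightarrow> norm (mp_eval P \<mu> *v x) \<le> c * mp_norm m D"
    and "\<exists>D\<in>S. mp_eval P \<mu> *v x + mp_eval D \<mu> *v x = 0
           \<and> c * mp_norm m D = norm (mp_eval P \<mu> *v x)"
proof -
  assume D: "D \<in> S" "mp_eval P \<mu> *v x + mp_eval D \<mu> *v x = 0"
  then have "norm (mp_eval P \<mu> *v x) = norm (mp_eval D \<mu> *v x)"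
    by (metis add_eq_0_iff2 norm_minus_cancel)
  also have "\<dots> \<le> norm (mp_eval D \<mu>)"
    using norm_matrix_vector_mult_le[of "mp_eval D \<mu>" x] assms by simp
  also have "\<dots> \<le> c * mp_norm m D"
    using assms D by (auto simp: tight_evaluation_def)
  finally show "norm (mp_eval P \<mu> *v x) \<le> c * mp_norm m D" .
next
  obtain M where M: "M *v x = - (mp_eval P \<mu> *v x)" "norm M = norm (mp_eval P \<mu> *v x)"
    using ex_matrix_mapping_unit_vector[OF assms(2), of "- (mp_eval P \<mu> *v x)"] by auto
  obtain D where "D \<in> S" "mp_eval D \<mu> = M" "c * mp_norm m D = norm M"
    using assms unfolding tight_evaluation_def by blast
  with M show "\<exists>D\<in>S. mp_eval P \<mu> *v x + mp_eval D \<mu> *v x = 0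
           \<and> c * mp_norm m D = norm (mp_eval P \<mu> *v x)"
    by (intro bexI[of _ D]) auto
qed

lemma backward_error_vec_tight_evaluation:
  assumes "tight_evaluation m S \<mu> c" "norm x = 1"
  shows "backward_error_vec m S \<mu> x P = norm (mp_eval P \<mu> *v x) / c"
  unfolding backward_error_vec_def
proof (rule cInf_eq_minimum)
  have c: "c > 0" using assms by (simp add: tight_evaluation_def)
  show "norm (mp_eval P \<mu> *v x) / c
      \<in> {mp_norm m D |D. D \<in> S \<and> mp_eval P \<mu> *v x + mp_eval D \<mu> *v x = 0}"
    using tight_evaluation_residual(2)[OF assms, of P] c by (force simp: field_simps)
  show "norm (mp_eval P \<mu> *v x) / c \<le> r"
    if "r \<in> {mp_norm m D |D. D \<in> S \<and> mp_eval P \<mu> *v x + mp_eval D \<mu> *v x = 0}" for r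
    using tight_evaluation_residual(1)[OF assms, of _ P] c that by (auto simp: field_simps)
qed

text \<open>Compactness of the unit sphere.\<close>

lemma ex_least_norm_unit_vector:
  fixes A :: "complex^'n^'m"
  shows "\<exists>x. norm x = 1 \<and> (\<forall>y. norm y = 1 \<longrightarrow> norm (A *v x) \<le> norm (A *v y))"
proof -
  have "continuous_on (sphere 0 1) (\<lambda>x. norm (A *v x))"
    unfolding matrix_vector_mult_def
    by (intro continuous_intros continuous_on_vec_lambda)
  moreover obtain v :: "complex^'n" where "norm v = 1"
    using vector_choose_size[of 1] by auto
  ultimately show ?thesis
    using continuous_attains_inf[of "sphere (0::complex^'n) 1" "\<lambda>x. norm (A *v x)"]
    by (fastforce simp: dist_norm)
qed

text \<open>Dividing all residuals by the same \<open>c\<close> preserves their order, so a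
  minimizer of the residual attains the minimum that \<open>LEAST\<close> asks for. The condition on
  \<open>x\<close> does not mention \<open>S\<close>.\<close>

lemma backward_error_tight_evaluation:
  assumes "tight_evaluation m S \<mu> c"
    and "norm x = 1"
    and "\<And>y. norm y = 1 \<Longrightarrow> norm (mp_eval P \<mu> *v x) \<le> norm (mp_eval P \<mu> *v y)"
  shows "backward_error m S \<mu> P = norm (mp_eval P \<mu> *v x) / c"
  unfolding backward_error_def
proof (rule Least_equality)
  show "norm (mp_eval P \<mu> *v x) / c \<in> {backward_error_vec m S \<mu> x P |x. norm x = 1}"
    using backward_error_vec_tight_evaluation[OF assms(1,2), of P] assms(2) by force
  show "norm (mp_eval P \<mu> *v x) / c \<le> r"
    if "r \<in> {backward_error_vec m S \<mu> x P |x. norm x = 1}" for r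
    using that assms by (auto simp: backward_error_vec_tight_evaluation tight_evaluation_def
        intro!: divide_right_mono)
qed

text \<open>Singularity of the perturbed matrix means that some unit vector is annihilated. For a
  fixed vector the cheapest such perturbation costs its residual divided by
  \<open>c\<close>.\<close>

lemma pseudospectrum_tight_evaluation:
  assumes "tight_evaluation m S \<mu> c" "P \<in> mat_polys m"
  shows "\<mu> \<in> pseudospectrum m S \<epsilon> P \<longleftrightarrow> (\<exists>x. norm x = 1 \<and> norm (mp_eval P \<mu> *v x) \<le> c * \<epsilon>)"
proof -
  have c: "c > 0" using assms by (simp add: tight_evaluation_def)
  have "det (mp_eval (P + D) \<mu>) = 0 \<longleftrightarrow>
      (\<exists>x. norm x = 1 \<and> mp_eval P \<mu> *v x + mp_eval D \<mu> *v x = 0)" if "D \<in> S" for D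
    using assms that
    by (auto simp: det_eq_0_iff_unit_kernel mp_eval_add[of _ m] tight_evaluation_def mat_polys_def
        matrix_vector_mult_add_rdistrib subset_iff)
  then have "\<mu> \<in> pseudospectrum m S \<epsilon> P \<longleftrightarrow>
      (\<exists>D\<in>S. mp_norm m D \<le> \<epsilon> \<and>
         (\<exists>x. norm x = 1 \<and> mp_eval P \<mu> *v x + mp_eval D \<mu> *v x = 0))"
    unfolding pseudospectrum_def mp_spectrum_def by auto
  also have "\<dots> \<longleftrightarrow> (\<exists>x. norm x = 1 \<and> norm (mp_eval P \<mu> *v x) \<le> c * \<epsilon>)"
  proof
    assume "\<exists>D\<in>S. mp_norm m D \<le> \<epsilon> \<and>
         (\<exists>x. norm x = 1 \<and> mp_eval P \<mu> *v x + mp_eval D \<mu> *v x = 0)"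
    then obtain D x where D: "D \<in> S" "mp_norm m D \<le> \<epsilon>" "norm x = 1"
      "mp_eval P \<mu> *v x + mp_eval D \<mu> *v x = 0" by auto
    then have "norm (mp_eval P \<mu> *v x) \<le> c * mp_norm m D"
      using tight_evaluation_residual(1) assms(1) by blast
    also have "\<dots> \<le> c * \<epsilon>" using D c by simp
    finally show "\<exists>x. norm x = 1 \<and> norm (mp_eval P \<mu> *v x) \<le> c * \<epsilon>" using D by blast
  next
    assume "\<exists>x. norm x = 1 \<and> norm (mp_eval P \<mu> *v x) \<le> c * \<epsilon>"
    then obtain x where x: "norm x = 1" "norm (mp_eval P \<mu> *v x) \<le> c * \<epsilon>" by auto
    obtain D where D: "D \<in> S" "mp_eval P \<mu> *v x + mp_eval D \<mu> *v x = 0"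
      "c * mp_norm m D = norm (mp_eval P \<mu> *v x)"
      using tight_evaluation_residual(2)[OF assms(1) x(1)] by blast
    then have "c * mp_norm m D \<le> c * \<epsilon>" using x by simp
    then have "mp_norm m D \<le> \<epsilon>" using c by simp
    then show "\<exists>D\<in>S. mp_norm m D \<le> \<epsilon> \<and>
         (\<exists>x. norm x = 1 \<and> mp_eval P \<mu> *v x + mp_eval D \<mu> *v x = 0)"
      using D x by blast
  qed
  finally show ?thesis .
qed

section \<open>Unstructured perturbations on the unit circle\<close>

lemma norm_cscale_power_unit: "cmod \<mu> = 1 \<Longrightarrow> norm (cscale (\<mu> ^ j) A) = norm A"
  by (simp add: norm_cscale norm_power)

lemma cscale_power_cnj_unit: "cmod \<mu> = 1 \<Longrightarrow> cscale (\<mu> ^ j) (cscale (cnj \<mu> ^ j) A) = A"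
  by (simp add: cscale_cscale power_mult_distrib[symmetric] complex_norm_square[symmetric] cscale_one)

lemma tight_evaluation_mat_polys:
  fixes m :: nat
  assumes "cmod \<mu> = 1"
  shows "tight_evaluation m (mat_polys m :: (complex^'n^'n) poly set) \<mu> (sqrt (m + 1))"
  unfolding tight_evaluation_def
proof (intro conjI ballI allI)
  fix D :: "(complex^'n^'n) poly" assume "D \<in> mat_polys m"
  then have "(norm (mp_eval D \<mu>))\<^sup>2 \<le> (m + 1) * (mp_norm m D)\<^sup>2"
    using norm_sum_power2_le[of "\<lambda>j. cscale (\<mu> ^ j) (coeff D j)" "{..m}"] assms
    by (simp add: mp_eval_eq_sum[of _ m] mat_polys_def norm_cscale_power_unit mp_norm_power2)
  then have "(norm (mp_eval D \<mu>))\<^sup>2 \<le> (sqrt (m + 1) * mp_norm m D)\<^sup>2"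
    by (simp add: power_mult_distrib)
  then show "norm (mp_eval D \<mu>) \<le> sqrt (m + 1) * mp_norm m D"
    by (rule power2_le_imp_le) (simp add: mp_norm_nonneg)
next
  fix M :: "complex^'n^'n"
  \<comment> \<open>The factor \<open>cnj \<mu> ^ j\<close> cancels \<open>\<mu> ^ j\<close> on the
    unit circle, so each of the \<open>m + 1\<close> terms of the value at \<open>\<mu>\<close> is
    an equal share of \<open>M\<close>.\<close>
  obtain D where D: "degree D \<le> m"
    "\<forall>j\<le>m. coeff D j = cscale (cnj \<mu> ^ j) ((1 / (m + 1)) *\<^sub>R M)"
    using ex_poly_of_coeffs[of m "\<lambda>j. cscale (cnj \<mu> ^ j) ((1 / (m + 1)) *\<^sub>R M)"] by blast
  have "mp_eval D \<mu> = (\<Sum>j\<le>m. (1 / (m + 1)) *\<^sub>R M)"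
    unfolding mp_eval_eq_sum[OF D(1)]
    by (rule sum.cong) (use D assms in \<open>simp_all add: cscale_power_cnj_unit\<close>)
  then have eval: "mp_eval D \<mu> = M"
    unfolding sum_constant_scaleR by simp
  have "(mp_norm m D)\<^sup>2 = (\<Sum>j\<le>m. (norm M / (m + 1))\<^sup>2)"
    unfolding mp_norm_power2
    by (rule sum.cong) (use D assms in \<open>simp_all add: norm_cscale_power_unit\<close>)
  then have "(sqrt (m + 1) * mp_norm m D)\<^sup>2 = (norm M)\<^sup>2"
    by (simp add: power_mult_distrib power_divide) (simp add: power2_eq_square)
  then have "sqrt (m + 1) * mp_norm m D = norm M"
    by (rule power2_eq_imp_eq) (simp_all add: mp_norm_nonneg)
  then show "\<exists>D\<in>mat_polys m. mp_eval D \<mu> = M \<and> sqrt (m + 1) * mp_norm m D = norm M"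
    using D eval by (auto simp: mat_polys_def)
qed auto

section \<open>Structured perturbations: splitting by parity of the index\<close>

text \<open>The parallelogram law; with equal norms, half the sum and half the difference are
  orthogonal.\<close>

lemma norm_half_sum_diff_power2:
  fixes a b :: "'a::real_inner"
  assumes "norm b = norm a"
  shows "(norm ((1/2) *\<^sub>R (a + b)))\<^sup>2 + (norm ((1/2) *\<^sub>R (a - b)))\<^sup>2 = (norm a)\<^sup>2"
proof -
  have "inner b b = inner a a" using assms by (simp add: norm_eq)
  then show ?thesis
    unfolding power2_norm_eq_inner
    by (simp add: inner_add_left inner_add_right inner_diff_left inner_diff_right inner_commute
        field_simps)
qed

lemma sum_even_odd:
  "(\<Sum>j\<le>m. f j) = (\<Sum>j | j \<le> m \<and> even j. f j) + (\<Sum>j | j \<le> m \<and> odd (j::nat). f j :: 'a::comm_monoid_add)"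
proof -
  have "{..m} = {j. j \<le> m \<and> even j} \<union> {j. j \<le> m \<and> odd j}" by auto
  then show ?thesis
    by (metis (mono_tags, lifting) disjoint_iff finite_Un finite_atMost mem_Collect_eq
        sum.union_disjoint)
qed

lemma card_even_odd:
  assumes "odd m"
  shows "card {j. j \<le> m \<and> even j} = (m + 1) div 2" "card {j. j \<le> m \<and> odd (j::nat)} = (m + 1) div 2"
proof -
  obtain q where m: "m = 2 * q + 1" using assms by (rule oddE)
  have "{j. j \<le> m \<and> even j} = (\<lambda>i. 2 * i) ` {..q}"
    unfolding m by (auto elim!: evenE)
  moreover have "{j. j \<le> m \<and> odd j} = (\<lambda>i. 2 * i + 1) ` {..q}"
    unfolding m by (auto elim!: oddE)
  ultimately show "card {j. j \<le> m \<and> even j} = (m + 1) div 2" "card {j. j \<le> m \<and> odd j} = (m + 1) div 2"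
    by (simp_all add: card_image inj_on_def m)
qed

lemma mp_eval_even_odd_part:
  assumes "degree D \<le> m"
  shows "(1/2) *\<^sub>R (mp_eval D z + mp_eval D (- z)) = (\<Sum>j | j \<le> m \<and> even j. cscale (z ^ j) (coeff D j))"
    and "(1/2) *\<^sub>R (mp_eval D z - mp_eval D (- z)) = (\<Sum>j | j \<le> m \<and> odd j. cscale (z ^ j) (coeff D j))"
proof -
  let ?E = "\<Sum>j | j \<le> m \<and> even j. cscale (z ^ j) (coeff D j)"
  let ?O = "\<Sum>j | j \<le> m \<and> odd j. cscale (z ^ j) (coeff D j)"
  have "mp_eval D z = ?E + ?O"
    unfolding mp_eval_eq_sum[OF assms] by (rule sum_even_odd)
  moreover have "mp_eval D (- z) = ?E - ?O"
    unfolding mp_eval_eq_sum[OF assms]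
    by (subst sum_even_odd) (simp add: cscale_minus sum_negf)
  ultimately show "(1/2) *\<^sub>R (mp_eval D z + mp_eval D (- z)) = ?E"
    "(1/2) *\<^sub>R (mp_eval D z - mp_eval D (- z)) = ?O"
    by (simp_all add: scaleR_2[symmetric])
qed

text \<open>The sign \<open>s = 1\<close> gives \<open>T_even\<close> and \<open>s = - 1\<close>
  gives \<open>T_odd\<close>, so that one proof covers both.\<close>

definition T_sym :: "nat \<Rightarrow> real \<Rightarrow> (complex^'n^'n) poly set" where
  "T_sym m s = {P \<in> mat_polys m. \<forall>z. transpose (mp_eval P z) = s *\<^sub>R mp_eval P (- z)}"

lemma tight_evaluation_T_sym:
  fixes m :: nat
  assumes "odd m" "cmod \<mu> = 1" "\<bar>s\<bar> = 1"
  shows "tight_evaluation m (T_sym m s :: (complex^'n^'n) poly set) \<mu> (sqrt ((m + 1) / 2))"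
proof -
  have half: "real ((m + 1) div 2) = (m + 1) / 2"
    using assms by (auto elim!: oddE)
  have ss: "s * s = 1" using assms(3) by (metis abs_mult_self_eq mult_1)
  show ?thesis
    unfolding tight_evaluation_def
  proof (intro conjI ballI allI)
    fix D :: "(complex^'n^'n) poly" assume D: "D \<in> T_sym m s"
    then have deg: "degree D \<le> m" by (simp add: T_sym_def mat_polys_def)
    \<comment> \<open>By the symmetry, the values at \<open>\<mu>\<close> and \<open>- \<mu>\<close>
      have equal norms, so the even and odd parts of the value at \<open>\<mu>\<close> obey
      Pythagoras.\<close>
    have "norm (mp_eval D (- \<mu>)) = norm (transpose (mp_eval D \<mu>))"
      using D assms(3) by (simp add: T_sym_def del: norm_transpose)
    then have "(norm (mp_eval D \<mu>))\<^sup>2 =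
        (norm (\<Sum>j | j \<le> m \<and> even j. cscale (\<mu> ^ j) (coeff D j)))\<^sup>2 +
        (norm (\<Sum>j | j \<le> m \<and> odd j. cscale (\<mu> ^ j) (coeff D j)))\<^sup>2"
      using norm_half_sum_diff_power2[of "mp_eval D (- \<mu>)" "mp_eval D \<mu>"]
      by (simp only: mp_eval_even_odd_part[OF deg] norm_transpose)
    \<comment> \<open>As \<open>m\<close> is odd, both parities have the same number of indices. The
      common factor lets the two sums recombine to \<open>mp_norm\<close>.\<close>
    also have "\<dots> \<le> (m + 1) / 2 * (\<Sum>j | j \<le> m \<and> even j. (norm (coeff D j))\<^sup>2) +
        (m + 1) / 2 * (\<Sum>j | j \<le> m \<and> odd j. (norm (coeff D j))\<^sup>2)"
      using norm_sum_power2_le[of "\<lambda>j. cscale (\<mu> ^ j) (coeff D j)" "{j. j \<le> m \<and> even j}"]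
        norm_sum_power2_le[of "\<lambda>j. cscale (\<mu> ^ j) (coeff D j)" "{j. j \<le> m \<and> odd j}"]
      unfolding card_even_odd[OF assms(1)] half norm_cscale_power_unit[OF assms(2)]
      by (rule add_mono)
    also have "\<dots> = (m + 1) / 2 * (mp_norm m D)\<^sup>2"
      unfolding mp_norm_power2 sum_even_odd[of _ m] by (simp add: distrib_left)
    finally have "(norm (mp_eval D \<mu>))\<^sup>2 \<le> (sqrt ((m + 1) / 2) * mp_norm m D)\<^sup>2"
      by (simp add: power_mult_distrib)
    then show "norm (mp_eval D \<mu>) \<le> sqrt ((m + 1) / 2) * mp_norm m D"
      by (rule power2_le_imp_le) (simp add: mp_norm_nonneg)
  next
    fix M :: "complex^'n^'n"
    define k where "k = (m + 1) / 2"
    have k: "k > 0" by (simp add: k_def)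
    \<comment> \<open>Only the parity of \<open>j\<close> matters. For \<open>s = 1\<close>,
      \<open>B 0\<close> is the symmetric and \<open>B 1\<close> the skew-symmetric part of
      \<open>M\<close>; for \<open>s = - 1\<close> the roles are exchanged.\<close>
    define B where "B j = (1/2) *\<^sub>R (if even j then M + s *\<^sub>R transpose M else M - s *\<^sub>R transpose M)"
      for j :: nat
    have transpose_B: "transpose (B j) = ((-1) ^ j * s) *\<^sub>R B j" for j
      using ss by (simp add: B_def transpose_scalar transpose_add transpose_diff
          scaleR_add_right scaleR_diff_right)
    have B_sum: "B 0 + B 1 = M"
      by (simp add: B_def scaleR_add_right[symmetric] scaleR_2[symmetric])
    have B_norm: "(norm (B 0))\<^sup>2 + (norm (B 1))\<^sup>2 = (norm M)\<^sup>2"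
      using norm_half_sum_diff_power2[of "s *\<^sub>R transpose M" M] assms(3) by (simp add: B_def)
    \<comment> \<open>There are \<open>k\<close> indices of each parity, so each coefficient carries
      the share \<open>1 / k\<close> of its part. The factor \<open>cnj \<mu> ^ j\<close> is a
      scalar and commutes with transposition, so it does not disturb the symmetry.\<close>
    obtain D where D: "degree D \<le> m" "\<forall>j\<le>m. coeff D j = cscale (cnj \<mu> ^ j) ((1 / k) *\<^sub>R B j)"
      using ex_poly_of_coeffs[of m "\<lambda>j. cscale (cnj \<mu> ^ j) ((1 / k) *\<^sub>R B j)"] by blast
    \<comment> \<open>No linearity of \<open>f\<close> is assumed: it is used for the value at
      \<open>\<mu>\<close> and for the squared norm.\<close>
    have sum_B: "(\<Sum>j\<le>m. f (B j)) = k *\<^sub>R (f (B 0) + f (B 1))" for f :: "complex^'n^'n \<Rightarrow> 'b::real_vector"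
    proof -
      have "(\<Sum>j | j \<le> m \<and> even j. f (B j)) = (\<Sum>j | j \<le> m \<and> even j. f (B 0))"
        "(\<Sum>j | j \<le> m \<and> odd j. f (B j)) = (\<Sum>j | j \<le> m \<and> odd j. f (B 1))"
        by (auto intro!: sum.cong simp: B_def)
      then show ?thesis
        unfolding sum_even_odd[of _ m] sum_constant_scaleR card_even_odd[OF assms(1)] half k_def
        by (simp only: sum_constant_scaleR card_even_odd[OF assms(1)] half scaleR_add_right)
    qed
    have "mp_eval D \<mu> = (\<Sum>j\<le>m. (1 / k) *\<^sub>R B j)"
      unfolding mp_eval_eq_sum[OF D(1)]
      by (rule sum.cong) (use D assms in \<open>simp_all add: cscale_power_cnj_unit\<close>)
    then have eval: "mp_eval D \<mu> = M"
      using sum_B[of "\<lambda>A. (1 / k) *\<^sub>R A"] k B_sum by (simp add: scaleR_add_right[symmetric])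
    have "(mp_norm m D)\<^sup>2 = (\<Sum>j\<le>m. (norm ((1 / k) *\<^sub>R B j))\<^sup>2)"
      unfolding mp_norm_power2
      by (rule sum.cong) (use D assms in \<open>simp_all add: norm_cscale_power_unit\<close>)
    also have "\<dots> = k * ((norm ((1 / k) *\<^sub>R B 0))\<^sup>2 + (norm ((1 / k) *\<^sub>R B 1))\<^sup>2)"
      using sum_B[of "\<lambda>A. (norm ((1 / k) *\<^sub>R A))\<^sup>2"] by simp
    also have "\<dots> = (norm M)\<^sup>2 / k"
      using k by (simp add: power_divide add_divide_distrib[symmetric] B_norm del: One_nat_def)
        (simp add: power2_eq_square)
    finally have "(sqrt k * mp_norm m D)\<^sup>2 = (norm M)\<^sup>2"
      using k by (simp add: power_mult_distrib)
    then have norm: "sqrt k * mp_norm m D = norm M"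
      by (rule power2_eq_imp_eq) (use k in \<open>simp_all add: mp_norm_nonneg\<close>)
    have "transpose (mp_eval D z) = s *\<^sub>R mp_eval D (- z)" for z
      unfolding mp_eval_eq_sum[OF D(1)] transpose_sum scaleR_sum_right
    proof (rule sum.cong)
      fix j assume "j \<in> {..m}"
      then have j: "coeff D j = cscale (cnj \<mu> ^ j) ((1 / k) *\<^sub>R B j)" using D by simp
      \<comment> \<open>The sign \<open>(-1) ^ j\<close> from transposing \<open>B j\<close> matches
        the one from \<open>(- z) ^ j\<close>, for arbitrary \<open>z\<close>.\<close>
      show "transpose (cscale (z ^ j) (coeff D j)) = s *\<^sub>R cscale ((- z) ^ j) (coeff D j)"
        unfolding transpose_cscale j transpose_scalar transpose_B cscale_scaleR power_minus[of z]
          cscale_power_minus_one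
        by (simp add: mult.commute)
    qed simp
    with D(1) have "D \<in> T_sym m s" by (simp add: T_sym_def mat_polys_def)
    with eval norm show "\<exists>D\<in>T_sym m s. mp_eval D \<mu> = M \<and> sqrt ((m + 1) / 2) * mp_norm m D = norm M"
      unfolding k_def by blast
  qed (auto simp: T_sym_def)
qed

theorem theorem5p2:
  fixes m :: nat
    and S :: "(complex^'n^'n) poly set"
    and P :: "(complex^'n^'n) poly"
    and \<epsilon> :: real
  assumes "odd m"
    and "S = T_even m \<or> S = T_odd m"
    and "P \<in> S"
    and "mp_regular P"
    and "\<epsilon> > 0"
    and "\<not> infinity_in_pseudospectrum m S \<epsilon> P"
    and "\<not> infinity_in_pseudospectrum m (mat_polys m) (\<epsilon> / sqrt 2) P"
  shows "(\<forall>\<mu>::complex. cmod \<mu> = 1 \<longrightarrow>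
            backward_error m S \<mu> P = sqrt 2 * backward_error m (mat_polys m) \<mu> P)
       \<and> pseudospectrum m S \<epsilon> P \<inter> {z. cmod z = 1} =
           pseudospectrum m (mat_polys m) (\<epsilon> / sqrt 2) P \<inter> {z. cmod z = 1}"
proof -
  have "S = T_sym m 1 \<or> S = T_sym m (- 1)"
    using assms(2) by (simp add: T_sym_def T_even_def T_odd_def)
  then have structured: "tight_evaluation m S \<mu> (sqrt ((m + 1) / 2))" if "cmod \<mu> = 1" for \<mu>
    using tight_evaluation_T_sym[OF assms(1) that, of 1] tight_evaluation_T_sym[OF assms(1) that, of "- 1"]
    by auto
  note unstructured = tight_evaluation_mat_polys[where ?'n = 'n and m = m]
  have P: "P \<in> mat_polys m"
    using assms(2,3) by (auto simp: T_even_def T_odd_def)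
  have "backward_error m S \<mu> P = sqrt 2 * backward_error m (mat_polys m) \<mu> P"
    if "cmod \<mu> = 1" for \<mu>
  proof -
    \<comment> \<open>One minimizer serves both backward errors, since the residual does not depend
      on the set of perturbations.\<close>
    obtain x where x: "norm x = 1"
      "\<And>y. norm y = 1 \<Longrightarrow> norm (mp_eval P \<mu> *v x) \<le> norm (mp_eval P \<mu> *v y)"
      using ex_least_norm_unit_vector[of "mp_eval P \<mu>"] by blast
    have "backward_error m S \<mu> P = norm (mp_eval P \<mu> *v x) / sqrt ((m + 1) / 2)"
      using structured[OF that] x by (rule backward_error_tight_evaluation)
    moreover have "backward_error m (mat_polys m) \<mu> P = norm (mp_eval P \<mu> *v x) / sqrt (m + 1)"
      using unstructured[OF that] x by (rule backward_error_tight_evaluation)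
    ultimately show ?thesis
      by (simp add: real_sqrt_divide)
  qed
  \<comment> \<open>The two thresholds for the residual coincide: \<open>sqrt ((m + 1) / 2) *
    \<epsilon> = sqrt (m + 1) * (\<epsilon> / sqrt 2)\<close>.\<close>
  moreover have "\<mu> \<in> pseudospectrum m S \<epsilon> P \<longleftrightarrow> \<mu> \<in> pseudospectrum m (mat_polys m) (\<epsilon> / sqrt 2) P"
    if "cmod \<mu> = 1" for \<mu>
    unfolding pseudospectrum_tight_evaluation[OF structured[OF that] P]
      pseudospectrum_tight_evaluation[OF unstructured[OF that] P]
    by (simp add: real_sqrt_divide)
  ultimately show ?thesis by blast
qed

end
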